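(* Let $m,n \ge 2$. If there exists a perfect $1$-error-correcting code in the Cartesian product $C_m \square C_n \square C_2$, then there exists a quasi-perfect $1$-error-correcting code in $C_m \square C_n \square C_4$, and hence in $C_m \square C_n \square C_{4k}$ for every positive integer $k$.
   Context: All graphs are simple and connected; $d(x,y)$ is the shortest-path distance. For $n\ge 3$, $C_n$ is the cycle on $n$ vertices; by convention $C_2$ is a single edge (i.e. $K_2$) and $C_1$ is a single vertex. The Cartesian product $G\square H$ has vertex set $V(G)\times V(H)$, with $(g_1,h_1)$ adjacent to $(g_2,h_2)$ iff either $h_1=h_2$ and $g_1g_2\in E(G)$, or $g_1=g_2$ and $h_1h_2\in E(H)$. A code is a subset $D$ of the vertex set. $D$ is $t$-error-correcting if any two distinct codewords are at distance at least $2t+1$. The covering radius of $D$ is the smallest $r$ such that every vertex is at distance at most $r$ from some codeword. A perfect $t$-error-correcting code is a $t$-error-correcting code with covering radius $t$; a quasi-perfect $t$-error-correcting code is a $t$-error-correcting code with covering radius $t+1$. *)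

theory Defs
  imports "Graph_Theory.Graph_Theory" "HOL-Library.Extended_Nat"
begin

text \<open>
  A simple graph is represented as a \<^locale>\<open>pair_graph\<close>: each edge \<open>uv\<close> is the pair of arcs
  \<open>(u, v)\<close> and \<open>(v, u)\<close>.
\<close>

text \<open>
  The condition \<open>i \<noteq> j\<close> removes the loop that would otherwise appear for \<open>n = 1\<close>, so the formula
  also covers the conventions \<open>C\<^sub>2 = K\<^sub>2\<close> and \<open>C\<^sub>1 = K\<^sub>1\<close>.
\<close>

definition cycle_graph :: "nat \<Rightarrow> nat pair_pre_digraph" where
  "cycle_graph n =
     \<lparr> pverts = {..<n},
       parcs = {(i, j). i < n \<and> j < n \<and> i \<noteq> j \<and> (j = Suc i mod n \<or> i = Suc j mod n)} \<rparr>"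

definition cartesian_graph_product ::
    "'a pair_pre_digraph \<Rightarrow> 'b pair_pre_digraph \<Rightarrow> ('a \<times> 'b) pair_pre_digraph"
    (infixl "\<box>" 70) where
  "G \<box> H =
     \<lparr> pverts = pverts G \<times> pverts H,
       parcs = {((g1, h1), (g2, h2)).
         (h1 = h2 \<and> h1 \<in> pverts H \<and> (g1, g2) \<in> parcs G) \<or>
         (g1 = g2 \<and> g1 \<in> pverts G \<and> (h1, h2) \<in> parcs H)} \<rparr>"

definition graph_dist :: "'a pair_pre_digraph \<Rightarrow> 'a \<Rightarrow> 'a \<Rightarrow> ereal" where
  "graph_dist G u v = wf_digraph.\<mu> (with_proj G) (\<lambda>_. 1) u v"

definition error_correcting :: "nat \<Rightarrow> 'a pair_pre_digraph \<Rightarrow> 'a set \<Rightarrow> bool" where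
  "error_correcting t G D \<longleftrightarrow>
     D \<subseteq> pverts G \<and>
     (\<forall>x\<in>D. \<forall>y\<in>D. x \<noteq> y \<longrightarrow> graph_dist G x y \<ge> ereal (real (2 * t + 1)))"

text \<open>
  The infimum in \<^typ>\<open>enat\<close> is a minimum when some \<open>r\<close> qualifies and \<open>\<infinity>\<close> otherwise; in particular
  the empty code in a nonempty graph has covering radius \<open>\<infinity>\<close>.
\<close>

definition covering_radius :: "'a pair_pre_digraph \<Rightarrow> 'a set \<Rightarrow> enat" where
  "covering_radius G D =
     (INF r \<in> {r. \<forall>v\<in>pverts G. \<exists>c\<in>D. graph_dist G v c \<le> ereal (real r)}. enat r)"

definition perfect_code :: "nat \<Rightarrow> 'a pair_pre_digraph \<Rightarrow> 'a set \<Rightarrow> bool" where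
  "perfect_code t G D \<longleftrightarrow> error_correcting t G D \<and> covering_radius G D = enat t"

definition quasi_perfect_code :: "nat \<Rightarrow> 'a pair_pre_digraph \<Rightarrow> 'a set \<Rightarrow> bool" where
  "quasi_perfect_code t G D \<longleftrightarrow> error_correcting t G D \<and> covering_radius G D = enat (t + 1)"

lemma pair_graph_cycle_graph: "pair_graph (cycle_graph n)"
proof
  show "finite (parcs (cycle_graph n))"
    by (rule finite_subset[of _ "{..<n} \<times> {..<n}"]) (auto simp: cycle_graph_def)
  show "symmetric (with_proj (cycle_graph n))"
    by (auto simp: cycle_graph_def symmetric_def sym_def)
qed (auto simp: cycle_graph_def)

lemma pair_graph_cartesian_graph_product:
  assumes "pair_graph G" "pair_graph H"
  shows "pair_graph (G \<box> H)"
proof -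
  interpret G: pair_graph G by fact
  interpret H: pair_graph H by fact
  have sub: "parcs (G \<box> H) \<subseteq> (pverts G \<times> pverts H) \<times> (pverts G \<times> pverts H)"
    by (auto simp: cartesian_graph_product_def dest: G.wellformed' H.wellformed')
  have fin: "finite (pverts G \<times> pverts H)"
    using G.pair_finite_verts H.pair_finite_verts by simp
  show ?thesis
  proof
    show "finite (pverts (G \<box> H))"
      using fin by (simp add: cartesian_graph_product_def)
    show "finite (parcs (G \<box> H))"
      using sub fin by (meson finite_SigmaI finite_subset)
    show "symmetric (with_proj (G \<box> H))"
      using G.pair_sym_arcs H.pair_sym_arcs
      by (auto simp: cartesian_graph_product_def symmetric_def sym_def)
    show "\<And>e. e \<in> parcs (G \<box> H) \<Longrightarrow> fst e \<noteq> snd e"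
      by (auto simp: cartesian_graph_product_def dest: G.no_loops' H.no_loops')
  qed (auto simp: cartesian_graph_product_def dest: G.wellformed' H.wellformed')
qed

lemma graph_dist_eq_INF_length:
  assumes "pair_graph G"
  shows "graph_dist G u v =
    (INF p \<in> {p. pre_digraph.awalk (with_proj G) u p v}. ereal (real (length p)))"
proof -
  interpret pair_graph G by fact
  have "awalk_cost (\<lambda>_. 1) p = real (length p)" for p
    by (induction p) auto
  then show ?thesis
    by (simp add: graph_dist_def \<mu>_def)
qed

end

theory Submission
  imports Defs
begin

text \<open>
  Split a perfect code of \<open>G \<box> K\<^sub>2\<close> into its layers \<open>A\<close> and \<open>B\<close>. In \<open>G \<box> C\<^bsub>4k\<^esub>\<close> put \<open>A\<close> on the layers
  congruent to \<open>0\<close>, \<open>B\<close> on those congruent to \<open>2\<close> modulo \<open>4\<close>, and nothing on the odd layers. Vertices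
  of \<open>A\<close> and \<open>B\<close> are nonadjacent and distinct in \<open>G\<close>, so the minimum distance remains at least \<open>3\<close>.
  A vertex of \<open>G\<close> is within distance \<open>1\<close> of \<open>A\<close> or lies in \<open>B\<close> (and vice versa), which gives covering
  radius at most \<open>2\<close>. It is not \<open>1\<close>, since \<open>B\<close> is nonempty as soon as \<open>G\<close> has an edge, and a vertex of
  \<open>B\<close> placed on layer \<open>0\<close> has no codeword within distance \<open>1\<close>.
\<close>

section \<open>Distance balls as powers of a relation\<close>

text \<open>Adjacency with a stationary step added at each vertex: by this padding, the single power
  \<open>near G ^^ r\<close> accounts for all walks of length at most \<open>r\<close>.\<close>

definition near :: "'a pair_pre_digraph \<Rightarrow> ('a \<times> 'a) set" where
  "near G = Id_on (pverts G) \<union> parcs G"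

lemma near_product:
  "((g, h), (g', h')) \<in> near (G \<box> H) \<longleftrightarrow>
    h = h' \<and> h \<in> pverts H \<and> (g, g') \<in> near G \<or> g = g' \<and> g \<in> pverts G \<and> (h, h') \<in> parcs H"
  by (auto simp: near_def cartesian_graph_product_def)

lemma near_sym:
  assumes "pair_graph G"
  shows "(u, v) \<in> near G \<longleftrightarrow> (v, u) \<in> near G"
proof -
  interpret pair_graph G by fact
  show ?thesis
    by (auto simp: near_def intro: arcs_symmetric)
qed

lemma near_verts:
  assumes "pair_graph G" "(u, v) \<in> near G"
  shows "u \<in> pverts G" "v \<in> pverts G"
proof -
  interpret pair_graph G by fact
  show "u \<in> pverts G" "v \<in> pverts G"
    using assms(2) by (auto simp: near_def dest: wellformed')
qed

text \<open>Induction on the first step: stationary steps pad a short walk and are dropped on the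
  way back. The condition on \<open>u\<close> matters at \<open>r = 0\<close>, where the power is
  the full identity but the empty walk must sit at a vertex.\<close>

lemma awalk_length_le_iff_relpow_near:
  assumes "pair_graph G" "u \<in> pverts G"
  shows "(\<exists>p. pre_digraph.awalk (with_proj G) u p v \<and> length p \<le> r) \<longleftrightarrow> (u, v) \<in> near G ^^ r"
  using assms(2)
proof (induction r arbitrary: u)
  interpret pair_graph G by fact
  case 0
  then show ?case
    by (auto simp: awalk_Nil_iff)
next
  interpret pair_graph G by fact
  case (Suc r)
  show ?case
  proof
    assume "\<exists>p. awalk u p v \<and> length p \<le> Suc r"
    then obtain p where p: "awalk u p v" "length p \<le> Suc r" by blast
    show "(u, v) \<in> near G ^^ Suc r"
    proof (cases p)
      case Nil
      then have "awalk u [] v" "(u, u) \<in> near G"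
        using p Suc.prems by (auto simp: near_def)
      then have "(u, v) \<in> near G ^^ r" "(u, u) \<in> near G"
        using Suc.IH[OF Suc.prems] by force+
      then show ?thesis
        by (rule relpow_Suc_I2[rotated])
    next
      case (Cons e q)
      then have e: "e \<in> parcs G" "u = fst e" and q: "awalk (snd e) q v"
        using p by (auto simp: awalk_Cons_iff)
      then have "(snd e, v) \<in> near G ^^ r"
        using Suc.IH[of "snd e"] p Cons by auto
      moreover have "(u, snd e) \<in> near G"
        using e by (auto simp: near_def)
      ultimately show ?thesis
        by (rule relpow_Suc_I2[rotated])
    qed
  next
    assume "(u, v) \<in> near G ^^ Suc r"
    then obtain w where w: "(u, w) \<in> near G" "(w, v) \<in> near G ^^ r"
      by (rule relpow_Suc_E2)
    then obtain p where p: "awalk w p v" "length p \<le> r"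
      using Suc.IH[of w] near_verts[OF assms(1)] by blast
    show "\<exists>p. awalk u p v \<and> length p \<le> Suc r"
    proof (cases "u = w")
      case True
      then show ?thesis using p le_SucI by blast
    next
      case False
      then have "awalk u ((u, w) # p) v"
        using w p by (auto simp: near_def awalk_Cons_iff)
      then show ?thesis using p by (intro exI[of _ "(u, w) # p"]) simp
    qed
  qed
qed

lemma graph_dist_le_and_ge_iff:
  assumes "pair_graph G" "u \<in> pverts G"
  shows graph_dist_le_iff: "graph_dist G u v \<le> ereal (real r) \<longleftrightarrow> (u, v) \<in> near G ^^ r"
    and graph_dist_ge_iff: "graph_dist G u v \<ge> ereal (real (Suc r)) \<longleftrightarrow> (u, v) \<notin> near G ^^ r"
proof -
  have le: "graph_dist G u v \<le> ereal (real r)" if uv: "(u, v) \<in> near G ^^ r"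
  proof -
    obtain p where p: "pre_digraph.awalk (with_proj G) u p v" "length p \<le> r"
      using awalk_length_le_iff_relpow_near[OF assms, THEN iffD2, OF uv] by blast
    then have "graph_dist G u v \<le> ereal (real (length p))"
      unfolding graph_dist_eq_INF_length[OF assms(1)] by (intro INF_lower) simp
    also have "\<dots> \<le> ereal (real r)" using p by simp
    finally show ?thesis .
  qed
  have ge: "graph_dist G u v \<ge> ereal (real (Suc r))" if "(u, v) \<notin> near G ^^ r"
    unfolding graph_dist_eq_INF_length[OF assms(1)]
  proof (rule INF_greatest)
    fix p assume "p \<in> {p. pre_digraph.awalk (with_proj G) u p v}"
    then have "\<not> length p \<le> r"
      using awalk_length_le_iff_relpow_near[OF assms, of v r] that by blast
    then show "ereal (real (Suc r)) \<le> ereal (real (length p))" by simp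
  qed
  \<comment> \<open>\<open>le\<close> and \<open>ge\<close> treat complementary cases and their
    bounds exclude each other, so both implications reverse.\<close>
  have "\<not> (ereal (real (Suc r)) \<le> x \<and> x \<le> ereal (real r))" for x
    by (cases x) auto
  with le ge show "graph_dist G u v \<le> ereal (real r) \<longleftrightarrow> (u, v) \<in> near G ^^ r"
    and "graph_dist G u v \<ge> ereal (real (Suc r)) \<longleftrightarrow> (u, v) \<notin> near G ^^ r"
    by blast+
qed

section \<open>Codes and covering radius in terms of \<open>near\<close>\<close>

lemma error_correcting_iff_near:
  assumes "pair_graph G"
  shows "error_correcting t G D \<longleftrightarrow>
    D \<subseteq> pverts G \<and> (\<forall>x\<in>D. \<forall>y\<in>D. (x, y) \<in> near G ^^ (2 * t) \<longrightarrow> x = y)"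
proof -
  have "graph_dist G x y \<ge> ereal (real (2 * t + 1)) \<longleftrightarrow> (x, y) \<notin> near G ^^ (2 * t)"
    if "x \<in> pverts G" for x y
    using graph_dist_ge_iff[OF assms that, of "2 * t" y] by simp
  then show ?thesis
    unfolding error_correcting_def by blast
qed

lemma relpow_2_iff: "(x, y) \<in> R ^^ 2 \<longleftrightarrow> (\<exists>z. (x, z) \<in> R \<and> (z, y) \<in> R)"
  by (auto simp: eval_nat_numeral)

text \<open>The admissible radii form an upward closed set, so the infimum is at most
  \<open>r\<close> exactly when \<open>r\<close> itself is admissible; an empty set gives infinity
  and fits as well.\<close>

lemma covering_radius_le_iff:
  assumes "pair_graph G"
  shows "covering_radius G D \<le> enat r \<longleftrightarrow> (\<forall>v\<in>pverts G. \<exists>c\<in>D. (v, c) \<in> near G ^^ r)"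
proof -
  define S where "S = {r. \<forall>v\<in>pverts G. \<exists>c\<in>D. graph_dist G v c \<le> ereal (real r)}"
  have S: "r \<in> S \<longleftrightarrow> (\<forall>v\<in>pverts G. \<exists>c\<in>D. (v, c) \<in> near G ^^ r)" for r
    by (simp add: S_def graph_dist_le_iff[OF assms])
  have mono: "s \<in> S" if "r \<in> S" "r \<le> s" for r s
  proof -
    have "ereal (real r) \<le> ereal (real s)" using that by simp
    then show ?thesis using that(1) order_trans unfolding S_def by blast
  qed
  have "covering_radius G D \<le> enat r \<longleftrightarrow> r \<in> S"
  proof
    assume "r \<in> S"
    then show "covering_radius G D \<le> enat r"
      unfolding covering_radius_def S_def[symmetric] by (rule INF_lower)
  next
    assume le: "covering_radius G D \<le> enat r"
    show "r \<in> S"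
    proof (rule ccontr)
      assume "r \<notin> S"
      then have "enat (Suc r) \<le> covering_radius G D"
        unfolding covering_radius_def S_def[symmetric]
        by (intro INF_greatest) (metis mono enat_ord_simps(1) not_less_eq_eq)
      then have "enat (Suc r) \<le> enat r" using le by (rule order_trans)
      then show False by simp
    qed
  qed
  then show ?thesis using S by simp
qed

lemma covering_radius_eq_Suc_iff:
  "covering_radius G D = enat (Suc r) \<longleftrightarrow>
    covering_radius G D \<le> enat (Suc r) \<and> \<not> covering_radius G D \<le> enat r"
  by (cases "covering_radius G D") auto

section \<open>Layers of the cycle and their residues modulo 4\<close>

lemma pverts_cycle_graph [simp]: "pverts (cycle_graph n) = {..<n}"
  by (simp add: cycle_graph_def)

lemma pverts_product [simp]: "pverts (G \<box> H) = pverts G \<times> pverts H"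
  by (simp add: cartesian_graph_product_def)

lemma parcs_cycle_graph_2: "(i, j) \<in> parcs (cycle_graph 2) \<longleftrightarrow> i < 2 \<and> j = 1 - i"
  by (auto simp: cycle_graph_def less_2_cases_iff)

lemma parcs_cycle_graph_4k_mod:
  assumes "(i, j) \<in> parcs (cycle_graph (4 * k))"
  shows "j mod 4 = Suc i mod 4 \<or> i mod 4 = Suc j mod 4"
  using assms by (auto simp: cycle_graph_def mod_mult_right_eq mod_mod_cancel)

lemma parcs_cycle_graph_Suc:
  assumes "i < n" "n \<ge> 2"
  shows "(i, Suc i mod n) \<in> parcs (cycle_graph n)" "(Suc i mod n, i) \<in> parcs (cycle_graph n)"
  using assms by (auto simp: cycle_graph_def mod_Suc)

text \<open>Two steps in the same direction shift the residue modulo 4 by 2, so equal residues force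
  the second step to undo the first.\<close>

lemma parcs_cycle_graph_4k_two_steps:
  assumes "(i, j) \<in> parcs (cycle_graph (4 * k))" "(j, l) \<in> parcs (cycle_graph (4 * k))"
    and "i mod 4 = l mod 4"
  shows "i = l"
proof -
  have lt: "i < 4 * k" "l < 4 * k"
    using assms by (auto simp: cycle_graph_def)
  have inj: "i = l" if "Suc i mod (4 * k) = Suc l mod (4 * k)"
    using that lt by (auto simp: mod_Suc split: if_splits)
  consider "j = Suc i mod (4 * k)" "j = Suc l mod (4 * k)"
    | "j = Suc i mod (4 * k)" "l = Suc j mod (4 * k)"
    | "i = Suc j mod (4 * k)" "j = Suc l mod (4 * k)"
    | "i = Suc j mod (4 * k)" "l = Suc j mod (4 * k)"
    using assms(1,2) by (auto simp: cycle_graph_def)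
  then show ?thesis
  proof cases
    case 1
    then show ?thesis using inj by simp
  next
    case 2
    then have "l mod 4 = Suc (Suc i) mod 4"
      by (simp add: mod_mod_cancel mod_Suc_eq)
    then have "i mod 4 = Suc (Suc i) mod 4" using assms(3) by simp
    then have False by presburger
    then show ?thesis ..
  next
    case 3
    then have "i mod 4 = Suc (Suc l) mod 4"
      by (simp add: mod_mod_cancel mod_Suc_eq)
    then have "l mod 4 = Suc (Suc l) mod 4" using assms(3) by simp
    then have False by presburger
    then show ?thesis ..
  next
    case 4
    then show ?thesis by simp
  qed
qed

section \<open>The construction over an arbitrary first factor\<close>

theorem quasi_perfect_code_product_cycle_4k:
  fixes G :: "'a pair_pre_digraph"
  assumes G: "pair_graph G" and arc: "(a, b) \<in> parcs G" and k: "k \<ge> 1"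
    and perf: "perfect_code 1 (G \<box> cycle_graph 2) D"
  shows "\<exists>D'. quasi_perfect_code 1 (G \<box> cycle_graph (4 * k)) D'"
proof -
  let ?P = "G \<box> cycle_graph 2" and ?Q = "G \<box> cycle_graph (4 * k)"
  have P: "pair_graph ?P" and Q: "pair_graph ?Q"
    using G by (simp_all add: pair_graph_cartesian_graph_product pair_graph_cycle_graph)
  interpret G: pair_graph G by fact
  define A where "A = {g. (g, 0) \<in> D}"
  define B where "B = {g. (g, 1) \<in> D}"
  define D' where "D' = {(g, j). j < 4 * k \<and> (j mod 4 = 0 \<and> g \<in> A \<or> j mod 4 = 2 \<and> g \<in> B)}"
  have D: "x = y" if "x \<in> D" "y \<in> D" "(x, z) \<in> near ?P" "(z, y) \<in> near ?P" for x y z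
  proof -
    have "(x, y) \<in> near ?P ^^ 2"
      using that by (auto simp only: relpow_2_iff)
    then show ?thesis
      using perf that by (simp add: perfect_code_def error_correcting_iff_near[OF P])
  qed
  have cover: "\<exists>c\<in>D. (v, c) \<in> near ?P" if "v \<in> pverts ?P" for v
    using perf that covering_radius_le_iff[OF P, of D 1] by (auto simp: perfect_code_def)
  have "D \<subseteq> pverts ?P"
    using perf by (simp add: perfect_code_def error_correcting_def)
  then have V: "A \<subseteq> pverts G" "B \<subseteq> pverts G"
    by (auto simp: A_def B_def)
  have sepA: "x = y" if "x \<in> A" "y \<in> A" "(x, z) \<in> near G" "(z, y) \<in> near G" for x y z
    using D[of "(x, 0)" "(y, 0)" "(z, 0)"] that by (simp add: A_def near_product)
  have sepB: "x = y" if "x \<in> B" "y \<in> B" "(x, z) \<in> near G" "(z, y) \<in> near G" for x y z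
    using D[of "(x, 1)" "(y, 1)" "(z, 1)"] that by (simp add: B_def near_product)
  \<comment> \<open>Otherwise \<open>(x, 0)\<close> and \<open>(y, 1)\<close> would be codewords
    within distance 2, by way of \<open>(y, 0)\<close>.\<close>
  have sepAB: "(x, y) \<notin> near G" if "x \<in> A" "y \<in> B" for x y
  proof
    assume "(x, y) \<in> near G"
    then show False
      using D[of "(x, 0)" "(y, 1)" "(y, 0)"] that V
      by (auto simp: A_def B_def near_product parcs_cycle_graph_2)
  qed
  \<comment> \<open>The only neighbour of \<open>(v, 0)\<close> outside its layer is
    \<open>(v, 1)\<close>.\<close>
  have covA: "v \<in> B \<or> (\<exists>c\<in>A. (v, c) \<in> near G)" if "v \<in> pverts G" for v
    using cover[of "(v, 0)"] that by (auto simp: A_def B_def near_product parcs_cycle_graph_2)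
  have covB: "v \<in> A \<or> (\<exists>c\<in>B. (v, c) \<in> near G)" if "v \<in> pverts G" for v
    using cover[of "(v, 1)"] that by (auto simp: A_def B_def near_product parcs_cycle_graph_2)
  have disj: "A \<inter> B = {}"
    using sepAB V by (fastforce simp: near_def)

  have "error_correcting 1 ?Q D'"
  proof -
    have "x = y"
      if xy: "x \<in> D'" "y \<in> D'" and steps: "(x, z) \<in> near ?Q" "(z, y) \<in> near ?Q" for x y z
    proof -
      obtain g i h j f l where eq: "x = (g, i)" "y = (h, j)" "z = (f, l)"
        by (cases x, cases y, cases z)
      have "i mod 4 = 0 \<or> i mod 4 = 2" "j mod 4 = 0 \<or> j mod 4 = 2"
        using xy by (auto simp: D'_def eq)
      then have even: "even i" "even j"
        by presburger+
      \<comment> \<open>Codewords lie on even layers, so two steps joining them change the layer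
        twice or not at all; a mixed pair of steps is impossible.\<close>
      have parity: "even p \<noteq> even q" if "(p, q) \<in> parcs (cycle_graph (4 * k))" for p q
        using parcs_cycle_graph_4k_mod[OF that] by (metis dvd_mod_iff even_Suc even_numeral)
      consider "i = l" "l = j" "(g, f) \<in> near G" "(f, h) \<in> near G"
        | "g = f" "f = h" "(i, l) \<in> parcs (cycle_graph (4 * k))" "(l, j) \<in> parcs (cycle_graph (4 * k))"
        using steps even parity by (auto simp: eq near_product)
      then show ?thesis
      proof cases
        case 1
        then show ?thesis
          using xy sepA[of g h f] sepB[of g h f] by (auto simp: D'_def eq)
      next
        case 2
        \<comment> \<open>Both codewords have the same first coordinate, which cannot lie in both
          \<open>A\<close> and \<open>B\<close>, so their layers have the same residue.\<close>
        then have "i mod 4 = j mod 4"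
          using xy disj by (auto simp: D'_def eq)
        then show ?thesis
          using 2 parcs_cycle_graph_4k_two_steps by (auto simp: eq)
      qed
    qed
    moreover have "D' \<subseteq> pverts ?Q"
      using V by (auto simp: D'_def)
    ultimately show ?thesis
      by (auto simp: error_correcting_iff_near[OF Q] relpow_2_iff)
  qed

  moreover have "covering_radius ?Q D' \<le> enat 2"
  proof -
    have "\<exists>c\<in>D'. \<exists>z. (v, z) \<in> near ?Q \<and> (z, c) \<in> near ?Q" if v: "v \<in> pverts ?Q" for v
    proof -
      obtain g i where eq: "v = (g, i)" by (cases v)
      then have g: "g \<in> pverts G" and i: "i < 4 * k" using v by auto
      define s where "s = Suc i mod (4 * k)"
      define t where "t = Suc s mod (4 * k)"
      have s: "s < 4 * k" "s mod 4 = Suc i mod 4" and t: "t < 4 * k" "t mod 4 = Suc s mod 4"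
        using k by (simp_all add: s_def t_def mod_mod_cancel)
      \<comment> \<open>The layer before \<open>i\<close>; adding \<open>4 * k - 1\<close> avoids
        truncated subtraction at \<open>i = 0\<close>.\<close>
      define p where "p = (i + (4 * k - 1)) mod (4 * k)"
      have p: "p < 4 * k" using k by (simp add: p_def)
      have Sp: "Suc p mod (4 * k) = i"
        using i k by (simp add: p_def mod_Suc_eq)
      then have pm: "i mod 4 = Suc p mod 4"
        by (metis mod_mod_cancel dvd_triv_left)
      have arcs: "(i, s) \<in> parcs (cycle_graph (4 * k))" "(s, t) \<in> parcs (cycle_graph (4 * k))"
        "(i, p) \<in> parcs (cycle_graph (4 * k))"
        using parcs_cycle_graph_Suc[of i "4 * k"] parcs_cycle_graph_Suc[of s "4 * k"]
          parcs_cycle_graph_Suc[of p "4 * k"] i s p k Sp by (auto simp: s_def t_def)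
      have stay: ?thesis if "(c, i) \<in> D'" "(g, c) \<in> near G" for c
      proof -
        have "(c, c) \<in> near G" using near_verts[OF G that(2)] by (auto simp: near_def)
        then show ?thesis
          using that(2) i by (intro bexI[OF _ that(1)] exI[of _ "(c, i)"]) (simp add: eq near_product)
      qed
      have up2: ?thesis if "(g, t) \<in> D'"
        using g arcs by (intro bexI[OF _ that] exI[of _ "(g, s)"]) (simp add: eq near_product)
      have up: ?thesis if "(c, s) \<in> D'" "(g, c) \<in> near G" for c
        using g arcs s that(2)
        by (intro bexI[OF _ that(1)] exI[of _ "(g, s)"]) (simp add: eq near_product)
      have down: ?thesis if "(g, p) \<in> D'"
      proof -
        have "(g, g) \<in> near G" using g by (auto simp: near_def)
        then show ?thesis
          using g arcs p by (intro bexI[OF _ that] exI[of _ "(g, p)"]) (simp add: eq near_product)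
      qed
      \<comment> \<open>On an even layer, either a codeword of the same layer is near or
        \<open>g\<close> itself carries one two layers up. On an odd layer, one adjacent layer holds
        \<open>A\<close> and the other \<open>B\<close>, so \<open>covA\<close> or
        \<open>covB\<close> gives a codeword straight below, or one reached by a step up and at most
        one step inside that layer.\<close>
      have "i mod 4 < 4" by simp
      then consider "i mod 4 = 0" | "i mod 4 = 1" | "i mod 4 = 2" | "i mod 4 = 3"
        by linarith
      then show ?thesis
      proof cases
        case 1
        then have "t mod 4 = 2" using s(2) t(2) by (simp add: mod_Suc)
        then show ?thesis using covA[OF g] stay up2 1 i t by (auto simp: D'_def)
      next
        case 2
        then have "s mod 4 = 2" "p mod 4 = 0" using s(2) pm by (simp_all add: mod_Suc split: if_splits)
        then show ?thesis using covB[OF g] up down s p by (auto simp: D'_def)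
      next
        case 3
        then have "t mod 4 = 0" using s(2) t(2) by (simp add: mod_Suc)
        then show ?thesis using covB[OF g] stay up2 3 i t by (auto simp: D'_def)
      next
        case 4
        then have "s mod 4 = 0" "p mod 4 = 2" using s(2) pm by (simp_all add: mod_Suc split: if_splits)
        then show ?thesis using covA[OF g] up down s p by (auto simp: D'_def)
      qed
    qed
    then show ?thesis
      unfolding covering_radius_le_iff[OF Q] by (auto simp: relpow_2_iff)
  qed

  moreover have "\<not> covering_radius ?Q D' \<le> enat 1"
  proof
    assume "covering_radius ?Q D' \<le> enat 1"
    then have cov: "\<exists>c\<in>D'. (v, c) \<in> near ?Q" if "v \<in> pverts ?Q" for v
      using that by (auto simp: covering_radius_le_iff[OF Q])
    have ab: "a \<in> pverts G" "b \<in> pverts G" "a \<noteq> b"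
      using arc G.wellformed' G.no_loops' by auto
    \<comment> \<open>If \<open>B\<close> were empty, \<open>covB\<close> would put both ends of the
      arc into \<open>A\<close>, against \<open>sepA\<close>.\<close>
    obtain x where x: "x \<in> B"
    proof (cases "B = {}")
      case True
      then have "a \<in> A" "b \<in> A" using covB ab by auto
      then show ?thesis using sepA[of a b b] ab arc by (auto simp: near_def)
    qed blast
    have "(x, 0) \<in> pverts ?Q" using x V k by auto
    then obtain c j where c: "(c, j) \<in> D'" "((x, 0), (c, j)) \<in> near ?Q"
      using cov by fast
    \<comment> \<open>The layers adjacent to layer 0 are odd and hold no codewords, so a codeword
      near \<open>(x, 0)\<close> lies in layer 0 and comes from \<open>A\<close>, against
      \<open>sepAB\<close>.\<close>
    have "\<not> (0, j) \<in> parcs (cycle_graph (4 * k))"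
      using parcs_cycle_graph_4k_mod[of 0 j k] c(1) by (auto simp: D'_def) presburger+
    then have "j = 0" "(x, c) \<in> near G"
      using c(2) by (auto simp: near_product)
    moreover from this have "c \<in> A" using c(1) by (simp add: D'_def)
    ultimately show False using sepAB x near_sym[OF G] by blast
  qed

  ultimately have "quasi_perfect_code 1 ?Q D'"
    using covering_radius_eq_Suc_iff[of ?Q D' 1]
    by (simp add: quasi_perfect_code_def eval_nat_numeral)
  then show ?thesis ..
qed

theorem theorem6:
  fixes m n :: nat
  assumes "m \<ge> 2" and "n \<ge> 2"
    and "\<exists>D. perfect_code 1 (cycle_graph m \<box> cycle_graph n \<box> cycle_graph 2) D"
  shows "(\<exists>D. quasi_perfect_code 1 (cycle_graph m \<box> cycle_graph n \<box> cycle_graph 4) D) \<and>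
    (\<forall>k::nat. k \<ge> 1 \<longrightarrow>
      (\<exists>D. quasi_perfect_code 1 (cycle_graph m \<box> cycle_graph n \<box> cycle_graph (4 * k)) D))"
proof -
  have G: "pair_graph (cycle_graph m \<box> cycle_graph n)"
    by (simp add: pair_graph_cartesian_graph_product pair_graph_cycle_graph)
  \<comment> \<open>An edge in the direction of the first cycle; \<open>m \<ge> 2\<close> makes 1 a
    vertex there.\<close>
  have arc: "((0, 0), (1, 0)) \<in> parcs (cycle_graph m \<box> cycle_graph n)"
    using assms(1,2) by (auto simp: cartesian_graph_product_def cycle_graph_def)
  obtain D where D: "perfect_code 1 (cycle_graph m \<box> cycle_graph n \<box> cycle_graph 2) D"
    using assms(3) by blast
  have "\<exists>D. quasi_perfect_code 1 (cycle_graph m \<box> cycle_graph n \<box> cycle_graph (4 * k)) D"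
    if "k \<ge> 1" for k
    by (rule quasi_perfect_code_product_cycle_4k[OF G arc that D])
  from this this[of 1] show ?thesis by simp
qed

end
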